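(* Let $\mathcal{T}$ be a generic quantum Markov semigroup on $M_d(\mathbb{C})$. Then $\mathcal{T}$ is irreducible if and only if the Lie algebra rank condition (LARC) holds with respect to the natural GKSL representation of its generator, i.e. the one given by the operators $L_{\ell k}$ ($\ell\neq k$) and $H$ in the definition of a generic quantum Markov semigroup.
   Context: Generic quantum Markov semigroup: let $(e_j)_{1\le j\le d}$ be an orthonormal basis of $\mathbb{C}^d$. For $\ell\neq k$ in $\{1,\dots,d\}$ let $\gamma_{\ell k}\ge0$ be constants and $L_{\ell k}=\gamma_{\ell k}^{1/2}|e_k\rangle\langle e_\ell|$ (the operator $v\mapsto\gamma_{\ell k}^{1/2}\langle e_\ell,v\rangle e_k$). Let $H$ be a self-adjoint operator diagonal in the basis $(e_j)$. The generic quantum Markov semigroup is $\mathcal{T}_t=e^{t\mathcal{L}}$, $t\ge0$, with generator $$\mathcal{L}(x)=\mathrm{i}[H,x]+\frac12\sum_{\ell\neq k}\left(-L_{\ell k}^*L_{\ell k}x+2L_{\ell k}^*xL_{\ell k}-xL_{\ell k}^*L_{\ell k}\right),\qquad x\in M_d(\mathbb{C}).$$ This expression of $\mathcal{L}$ through $H$ and the $L_{\ell k}$ is its natural GKSL (Gorini-Kossakowski-Sudarshan-Lindblad) representation. LARC: put $G=-\frac12\sum_{\ell\neq k}L_{\ell k}^*L_{\ell k}-\mathrm{i}H$ and $\widetilde{G}=G-\frac12\sum_{\ell\neq k}L_{\ell k}^2$. The LARC holds if for every non-zero $\xi\in\mathbb{C}^d$ the (complex) linear span of all vectors $A\xi$,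 where $A$ is one of $\widetilde{G}$, $L_{\ell k}$ ($\ell\neq k$), or any iterated commutator of these matrices (such as $[\widetilde{G},L_{\ell k}]$, $[L_{\ell k},L_{\ell' k'}]$, $[\widetilde{G},[\widetilde{G},L_{\ell k}]]$, $[\widetilde{G},[L_{\ell k},L_{\ell' k'}]]$, $\dots$, with $[A,B]=AB-BA$), is equal to $\mathbb{C}^d$. Irreducibility: a projection $p\in M_d(\mathbb{C})$ is subharmonic if $\mathcal{T}_t(p)\ge p$ for all $t\ge0$. $\mathcal{T}$ is irreducible if there is no non-trivial (different from $0$ and the identity) subharmonic projection.
   Formalization: The case d = 1 with H = 0 is excluded: there the semigroup is trivially irreducible, but there are no operators L and G-tilde is 0, so the LARC span is {0} and the stated equivalence fails. *)

theory Defs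
  imports "HOL-Analysis.Analysis"
begin

type_synonym 'n cvec = "complex ^ 'n"
type_synonym 'n cmat = "complex ^ 'n ^ 'n"

(* Antilinear in the first argument. The library's inner product on this type is only
   its real part. *)
definition cinner :: "'n::finite cvec \<Rightarrow> 'n cvec \<Rightarrow> complex" where
  "cinner u v = (\<Sum>i\<in>UNIV. cnj (u $ i) * v $ i)"

definition cscale :: "complex \<Rightarrow> 'n::finite cmat \<Rightarrow> 'n cmat" where
  "cscale c A = map_matrix (\<lambda>z. c * z) A"

(* The library's adjoint refers to the real inner product, hence this separate notion. *)
definition cadjoint :: "'n::finite cmat \<Rightarrow> 'n cmat" where
  "cadjoint A = map_matrix cnj (transpose A)"

(* |u><v|, that is, the operator sending w to <v,w> u *)
definition ketbra :: "'n::finite cvec \<Rightarrow> 'n cvec \<Rightarrow> 'n cmat" where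
  "ketbra u v = (\<chi> i j. u $ i * cnj (v $ j))"

definition commutator :: "'n::finite cmat \<Rightarrow> 'n cmat \<Rightarrow> 'n cmat" where
  "commutator A B = A ** B - B ** A"

definition selfadjoint :: "'n::finite cmat \<Rightarrow> bool" where
  "selfadjoint A \<longleftrightarrow> cadjoint A = A"

(* A family of CARD('n) orthonormal vectors in a CARD('n)-dimensional space is a basis. *)
definition orthonormal_basis :: "('n::finite \<Rightarrow> 'n cvec) \<Rightarrow> bool" where
  "orthonormal_basis e \<longleftrightarrow> (\<forall>i j. cinner (e i) (e j) = (if i = j then 1 else 0))"

definition diagonal_in :: "('n::finite \<Rightarrow> 'n cvec) \<Rightarrow> 'n cmat \<Rightarrow> bool" where
  "diagonal_in e A \<longleftrightarrow> (\<forall>i j. i \<noteq> j \<longrightarrow> cinner (e i) (A *v e j) = 0)"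

(* Order of positive semidefinite matrices; the values of the quadratic form are required to be
   real and non-negative. *)
definition loewner_le :: "'n::finite cmat \<Rightarrow> 'n cmat \<Rightarrow> bool" where
  "loewner_le A B \<longleftrightarrow> (\<forall>v. cinner v ((B - A) *v v) \<in> \<real>\<^sub>\<ge>\<^sub>0)"

definition projection :: "'n::finite cmat \<Rightarrow> bool" where
  "projection p \<longleftrightarrow> p ** p = p \<and> selfadjoint p"


(* GKSL generator in the Heisenberg picture, for Kraus operators L j indexed by j in J *)
definition gksl :: "'n::finite cmat \<Rightarrow> 'i set \<Rightarrow> ('i \<Rightarrow> 'n cmat) \<Rightarrow> 'n cmat \<Rightarrow> 'n cmat" where
  "gksl H J L x = cscale \<i> (commutator H x) +
     (1/2) *\<^sub>R (\<Sum>j\<in>J. - (cadjoint (L j) ** L j ** x)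
                      + 2 *\<^sub>R (cadjoint (L j) ** x ** L j)
                      - x ** cadjoint (L j) ** L j)"

(* exp (t F), as the exponential series of the linear map F evaluated at x *)
definition semigroup_of :: "('n::finite cmat \<Rightarrow> 'n cmat) \<Rightarrow> real \<Rightarrow> 'n cmat \<Rightarrow> 'n cmat" where
  "semigroup_of F t x = (\<Sum>m. (t ^ m / fact m) *\<^sub>R (F ^^ m) x)"

definition subharmonic :: "(real \<Rightarrow> 'n::finite cmat \<Rightarrow> 'n cmat) \<Rightarrow> 'n cmat \<Rightarrow> bool" where
  "subharmonic T p \<longleftrightarrow> projection p \<and> (\<forall>t\<ge>0. loewner_le p (T t p))"

definition irreducible_semigroup :: "(real \<Rightarrow> 'n::finite cmat \<Rightarrow> 'n cmat) \<Rightarrow> bool" where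
  "irreducible_semigroup T \<longleftrightarrow> (\<nexists>p. subharmonic T p \<and> p \<noteq> 0 \<and> p \<noteq> mat 1)"


definition drift :: "'n::finite cmat \<Rightarrow> 'i set \<Rightarrow> ('i \<Rightarrow> 'n cmat) \<Rightarrow> 'n cmat" where
  "drift H J L = - ((1/2) *\<^sub>R (\<Sum>j\<in>J. cadjoint (L j) ** L j)) - cscale \<i> H"

definition drift_tilde :: "'n::finite cmat \<Rightarrow> 'i set \<Rightarrow> ('i \<Rightarrow> 'n cmat) \<Rightarrow> 'n cmat" where
  "drift_tilde H J L = drift H J L - (1/2) *\<^sub>R (\<Sum>j\<in>J. L j ** L j)"

inductive_set iterated_commutators :: "'n::finite cmat set \<Rightarrow> 'n cmat set"
  for S :: "'n cmat set" where
  generator: "A \<in> S \<Longrightarrow> A \<in> iterated_commutators S"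
| bracket: "A \<in> iterated_commutators S \<Longrightarrow> B \<in> iterated_commutators S
            \<Longrightarrow> commutator A B \<in> iterated_commutators S"

(* vec.span is the complex linear span; plain span would be the real one. *)
definition LARC :: "'n::finite cmat \<Rightarrow> 'i set \<Rightarrow> ('i \<Rightarrow> 'n cmat) \<Rightarrow> bool" where
  "LARC H J L \<longleftrightarrow>
     (\<forall>\<xi>. \<xi> \<noteq> 0 \<longrightarrow>
        vec.span ((\<lambda>A. A *v \<xi>) ` iterated_commutators (insert (drift_tilde H J L) (L ` J))) = UNIV)"


definition off_diagonal :: "('n \<times> 'n) set" where
  "off_diagonal = {(l, k). l \<noteq> k}"

definition generic_L ::
    "('n::finite \<Rightarrow> 'n cvec) \<Rightarrow> ('n \<Rightarrow> 'n \<Rightarrow> real) \<Rightarrow> 'n \<times> 'n \<Rightarrow> 'n cmat" where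
  "generic_L e \<gamma> = (\<lambda>(l, k). sqrt (\<gamma> l k) *\<^sub>R ketbra (e k) (e l))"

definition generic_semigroup ::
    "('n::finite \<Rightarrow> 'n cvec) \<Rightarrow> ('n \<Rightarrow> 'n \<Rightarrow> real) \<Rightarrow> 'n cmat \<Rightarrow> real \<Rightarrow> 'n cmat \<Rightarrow> 'n cmat" where
  "generic_semigroup e \<gamma> H = semigroup_of (gksl H off_diagonal (generic_L e \<gamma>))"

end

theory Submission
  imports Defs
begin

text \<open>Call a set \<open>C\<close> of indices absorbing if no transition \<open>l \<rightarrow> k\<close> with positive rate leaves it. Both
  irreducibility and the rank condition say that there is no non-trivial absorbing set, except that
  in dimension one the rank condition needs \<open>H \<noteq> 0\<close>.

  If \<open>p\<close> is subharmonic, differentiating at \<open>t = 0\<close> gives \<open>\<langle>v, \<L>(p) v\<rangle> \<ge> 0\<close>; for \<open>v\<close> in the range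
  of \<open>p\<close> this number equals \<open>- \<Sum>\<^sub>j \<parallel>(1 - p) L\<^sub>j v\<parallel>\<^sup>2\<close>, so the range is invariant under every
  \<open>L\<^sub>j\<close> and the basis vectors it contains form an absorbing set. Conversely, the semigroup acts on
  diagonal matrices as a classical Markov semigroup, so the projection onto the span of an absorbing
  set is subharmonic. For the rank condition, brackets of consecutive matrix units along a path from
  \<open>l\<close> to \<open>k \<noteq> l\<close> yield the matrix unit \<open>|e\<^sub>k\<rangle>\<langle>e\<^sub>l|\<close>, while the span of an absorbing set is invariant
  under all generators and hence under their brackets.\<close>

section \<open>Linear maps on matrices, the complex inner product and rank-one operators\<close>

lemma linear_matrix_mult_left: "linear (\<lambda>X :: 'n::finite cmat. A ** X)"
  by (rule linearI) (simp_all add: matrix_add_ldistrib matrix_scalar_ac scalar_matrix_assoc)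

lemma linear_matrix_mult_right: "linear (\<lambda>X :: 'n::finite cmat. X ** A)"
  by (rule linearI)
     (simp_all add: matrix_matrix_mult_def vec_eq_iff algebra_simps sum.distrib scaleR_sum_right)

lemma scaleR_matrix_vector_mult: "(r *\<^sub>R A) *v v = r *\<^sub>R (A *v v)" for A :: "'n::finite cmat"
  by (simp add: matrix_vector_mult_def vec_eq_iff scaleR_sum_right)

lemma linear_matrix_vector_mult_left: "linear (\<lambda>X :: 'n::finite cmat. X *v v)"
  by (rule linearI) (simp_all add: matrix_vector_mult_add_rdistrib scaleR_matrix_vector_mult)

lemma linear_cscale: "linear (cscale c)"
  by (rule linearI) (simp_all add: cscale_def map_matrix_def vec_eq_iff algebra_simps)

lemma cscale_0 [simp]: "cscale 0 A = 0"
  by (simp add: cscale_def map_matrix_def vec_eq_iff)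

lemma cscale_of_real: "cscale (of_real r) A = r *\<^sub>R A"
  by (simp add: cscale_def map_matrix_def vec_eq_iff scaleR_conv_of_real[where 'a=complex])

lemma cscale_mult_vec: "cscale c A *v v = c *s (A *v v)"
  by (simp add: cscale_def map_matrix_def vec_eq_iff matrix_vector_mult_def sum_distrib_left mult_ac)

lemma cinner_add_right: "cinner u (v + w) = cinner u v + cinner u w"
  by (simp add: cinner_def algebra_simps sum.distrib)

lemma cinner_scale_right: "cinner u (c *s v) = c * cinner u v"
  by (simp add: cinner_def sum_distrib_left mult_ac)

lemma cinner_0_right [simp]: "cinner u 0 = 0"
  by (simp add: cinner_def)

lemma cinner_sum_right: "cinner u (\<Sum>i\<in>I. f i) = (\<Sum>i\<in>I. cinner u (f i))"
  by (induction I rule: infinite_finite_induct) (simp_all add: cinner_add_right)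

lemma cnj_cinner: "cnj (cinner u v) = cinner v u"
  by (simp add: cinner_def mult_ac)

lemma Re_cinner: "Re (cinner u v) = inner u v"
  by (simp add: cinner_def inner_vec_def inner_complex_def)

lemma cinner_cadjoint: "cinner (cadjoint A *v u) v = cinner u (A *v v)"
proof -
  have "cinner (cadjoint A *v u) v = (\<Sum>i\<in>UNIV. \<Sum>j\<in>UNIV. A $ j $ i * cnj (u $ j) * v $ i)"
    by (simp add: cinner_def cadjoint_def matrix_vector_mult_def transpose_def map_matrix_def
        sum_distrib_right)
  also have "\<dots> = (\<Sum>j\<in>UNIV. \<Sum>i\<in>UNIV. A $ j $ i * cnj (u $ j) * v $ i)"
    by (rule sum.swap)
  also have "\<dots> = cinner u (A *v v)"
    by (simp add: cinner_def matrix_vector_mult_def sum_distrib_left mult_ac)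
  finally show ?thesis .
qed

lemma cadjoint_cadjoint [simp]: "cadjoint (cadjoint A) = A"
  by (simp add: cadjoint_def map_matrix_def transpose_def vec_eq_iff)

lemma inner_cadjoint: "inner u (cadjoint A *v v) = inner (A *v u) v"
  by (metis Re_cinner cinner_cadjoint cadjoint_cadjoint)

lemma cadjoint_scaleR: "cadjoint (r *\<^sub>R A) = r *\<^sub>R cadjoint A"
  by (simp add: cadjoint_def map_matrix_def transpose_def vec_eq_iff)

lemma cadjoint_sum: "cadjoint (\<Sum>i\<in>I. f i) = (\<Sum>i\<in>I. cadjoint (f i))"
  by (simp add: cadjoint_def map_matrix_def transpose_def vec_eq_iff)

lemma ketbra_mult_vec: "ketbra u v *v w = cinner v w *s u"
  by (simp add: ketbra_def cinner_def matrix_vector_mult_def vec_eq_iff sum_distrib_left mult_ac)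

lemma ketbra_mult: "ketbra a b ** ketbra c d = cscale (cinner b c) (ketbra a d)"
  by (simp add: ketbra_def cinner_def cscale_def map_matrix_def matrix_matrix_mult_def vec_eq_iff
      sum_distrib_left sum_distrib_right mult_ac)

lemma cadjoint_ketbra: "cadjoint (ketbra u v) = ketbra v u"
  by (simp add: cadjoint_def map_matrix_def transpose_def ketbra_def vec_eq_iff)

lemma mult_ketbra: "A ** ketbra u v = ketbra (A *v u) v"
  by (simp add: ketbra_def matrix_matrix_mult_def matrix_vector_mult_def vec_eq_iff
      sum_distrib_left mult_ac)

lemma ketbra_mult': "ketbra u v ** A = ketbra u (cadjoint A *v v)"
  by (simp add: ketbra_def matrix_matrix_mult_def matrix_vector_mult_def vec_eq_iff cadjoint_def
      map_matrix_def transpose_def sum_distrib_left mult_ac)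

lemma ketbra_scale_left: "ketbra (c *s u) v = cscale c (ketbra u v)"
  by (simp add: ketbra_def cscale_def map_matrix_def vec_eq_iff)

lemma ketbra_scale_right: "ketbra u (c *s v) = cscale (cnj c) (ketbra u v)"
  by (simp add: ketbra_def cscale_def map_matrix_def vec_eq_iff mult_ac)

section \<open>Expansion in an orthonormal basis\<close>

text \<open>Orthonormality says that the matrix \<open>U\<close> with columns \<open>e j\<close> has
  its adjoint as left inverse. For a square matrix this is also a right inverse, and
  \<open>U ** cadjoint U = mat 1\<close> is the expansion.\<close>

lemma orthonormal_expansion:
  assumes "orthonormal_basis e"
  shows "(\<Sum>i\<in>UNIV. cinner (e i) v *s e i) = v"
proof -
  define U where "U = (\<chi> i j. e j $ i)"
  have "cadjoint U ** U = mat 1"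
    using assms unfolding orthonormal_basis_def cinner_def U_def cadjoint_def map_matrix_def
      transpose_def matrix_matrix_mult_def mat_def by (simp add: vec_eq_iff)
  then have "U ** cadjoint U = mat 1"
    by (rule matrix_left_right_inverse1)
  then have "U *v (cadjoint U *v v) = v"
    by (simp add: matrix_vector_mul_assoc)
  moreover have "cadjoint U *v v = (\<chi> i. cinner (e i) v)"
    by (simp add: U_def cadjoint_def map_matrix_def transpose_def matrix_vector_mult_def cinner_def)
  moreover have "U *v (\<chi> i. c i) = (\<Sum>i\<in>UNIV. c i *s e i)" for c
    by (simp add: U_def matrix_vector_mult_def vec_eq_iff mult_ac)
  ultimately show ?thesis by simp
qed

lemma diagonal_in_eigenvector:
  assumes "orthonormal_basis e" "diagonal_in e H"
  shows "H *v e l = cinner (e l) (H *v e l) *s e l"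
proof -
  have "H *v e l = (\<Sum>i\<in>UNIV. cinner (e i) (H *v e l) *s e i)"
    by (rule orthonormal_expansion[OF assms(1), symmetric])
  also have "\<dots> = (\<Sum>i\<in>UNIV. if i = l then cinner (e l) (H *v e l) *s e l else 0)"
    using assms(2) by (intro sum.cong) (auto simp: diagonal_in_def)
  finally show ?thesis by simp
qed

section \<open>The exponential series of a linear map\<close>

lemma linear_gksl: "linear (gksl H J L)"
  unfolding gksl_def commutator_def
  by (intro linear_compose_add linear_compose_sub linear_compose_neg linear_compose_sum
      linear_compose_scale_right ballI linear_compose[OF _ linear_cscale, unfolded o_def]
      linear_matrix_mult_left linear_matrix_mult_right
      linear_compose[OF linear_matrix_mult_left linear_matrix_mult_right, unfolded o_def]
      linear_compose[OF linear_matrix_mult_right linear_matrix_mult_right, unfolded o_def])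

lemma norm_funpow_le:
  fixes F :: "'a::real_normed_vector \<Rightarrow> 'a"
  assumes "\<And>x. norm (F x) \<le> K * norm x" "K \<ge> 0"
  shows "norm ((F ^^ m) x) \<le> K ^ m * norm x"
proof (induction m)
  case (Suc m)
  have "norm ((F ^^ Suc m) x) \<le> K * norm ((F ^^ m) x)"
    using assms(1) by simp
  also have "\<dots> \<le> K * (K ^ m * norm x)"
    using Suc assms(2) by (intro mult_left_mono)
  finally show ?case by (simp add: mult_ac)
qed simp

text \<open>In finite dimension a linear map is bounded by some \<open>K\<close>, so the exponential
  series of \<open>\<bar>t\<bar> * K\<close> is a majorant.\<close>

lemma summable_norm_exp_series:
  fixes F :: "'a::euclidean_space \<Rightarrow> 'a"
  assumes "linear F"
  shows "summable (\<lambda>m. norm ((t ^ m / fact m) *\<^sub>R (F ^^ m) x))"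
proof -
  obtain K where K: "K > 0" "\<And>x. norm (F x) \<le> K * norm x"
    using linear_bounded_pos[OF assms] by blast
  have "norm ((t ^ m / fact m) *\<^sub>R (F ^^ m) x) \<le> norm x * (inverse (fact m) * (\<bar>t\<bar> * K) ^ m)" for m
  proof -
    have "norm ((t ^ m / fact m) *\<^sub>R (F ^^ m) x) \<le> \<bar>t\<bar> ^ m / fact m * (K ^ m * norm x)"
      using norm_funpow_le[of F K, OF K(2)] K(1)
      by (simp add: power_abs del: times_divide_eq_left) (intro mult_left_mono, auto)
    then show ?thesis by (simp add: power_mult_distrib field_simps)
  qed
  then show ?thesis
    by (intro summable_comparison_test'[OF summable_mult[OF summable_exp]]) simp
qed

lemma summable_exp_series:
  fixes F :: "'a::euclidean_space \<Rightarrow> 'a"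
  assumes "linear F"
  shows "summable (\<lambda>m. (t ^ m / fact m) *\<^sub>R (F ^^ m) x)"
  by (rule summable_norm_cancel[OF summable_norm_exp_series[OF assms]])

text \<open>Along the semigroup, \<open>\<phi>\<close> is an everywhere convergent power series in
  \<open>t\<close> whose derivative at 0 is \<open>\<phi> (F x)\<close>. A negative derivative would
  push the value below \<open>\<phi> x\<close> for small positive \<open>t\<close>.\<close>

lemma generator_nonneg:
  fixes F :: "'n::finite cmat \<Rightarrow> 'n cmat"
  assumes "linear F" and \<phi>: "bounded_linear \<phi>"
    and le: "\<And>t. t \<ge> 0 \<Longrightarrow> \<phi> x \<le> (\<phi> (semigroup_of F t x) :: real)"
  shows "\<phi> (F x) \<ge> 0"
proof (rule ccontr)
  assume neg: "\<not> \<phi> (F x) \<ge> 0"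
  define a where "a m = \<phi> ((F ^^ m) x) / fact m" for m
  interpret \<phi>: bounded_linear \<phi> by (rule \<phi>)
  have a: "a m * t ^ m = \<phi> ((t ^ m / fact m) *\<^sub>R (F ^^ m) x)" for m t
    by (simp add: a_def \<phi>.scaleR)
  have sa: "summable (\<lambda>m. a m * t ^ m)" for t
    unfolding a by (rule \<phi>.summable[OF summable_exp_series[OF assms(1)]])
  have eq: "(\<Sum>m. a m * t ^ m) = \<phi> (semigroup_of F t x)" for t
    unfolding a semigroup_of_def by (rule \<phi>.suminf[OF summable_exp_series[OF assms(1)], symmetric])
  have "((\<lambda>t. \<Sum>m. a m * t ^ m) has_field_derivative (\<Sum>m. diffs a m * 0 ^ m)) (at 0)"
    by (rule termdiffs_strong_converges_everywhere[OF sa])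
  then have "((\<lambda>t. \<phi> (semigroup_of F t x)) has_field_derivative \<phi> (F x)) (at 0)"
    unfolding eq powser_zero by (simp add: diffs_def a_def)
  from DERIV_neg_dec_right[OF this] neg obtain d where d: "d > 0"
    "\<And>h. 0 < h \<Longrightarrow> h < d \<Longrightarrow> \<phi> (semigroup_of F h x) < \<phi> (semigroup_of F 0 x)"
    by auto
  have "\<phi> (semigroup_of F 0 x) = \<phi> x"
    using eq[of 0] by (simp only: powser_zero) (simp add: a_def)
  with d(2)[of "d/2"] le[of "d/2"] d(1) show False by simp
qed

text \<open>The binomial theorem for \<open>F\<close> and \<open>c\<close> times the identity, which
  commute by linearity of \<open>F\<close>.\<close>

lemma funpow_add_scaleR:
  fixes F :: "'a::real_vector \<Rightarrow> 'a"
  assumes "linear F"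
  shows "((\<lambda>x. F x + c *\<^sub>R x) ^^ m) x = (\<Sum>i\<le>m. (real (m choose i) * c ^ (m - i)) *\<^sub>R (F ^^ i) x)"
proof (induction m)
  case (Suc m)
  define g where "g i = (real (m choose i) * c ^ (Suc m - i)) *\<^sub>R (F ^^ i) x" for i
  have "((\<lambda>x. F x + c *\<^sub>R x) ^^ Suc m) x
      = (\<Sum>i\<le>m. (real (m choose i) * c ^ (m - i)) *\<^sub>R (F ^^ Suc i) x)
        + c *\<^sub>R (\<Sum>i\<le>m. (real (m choose i) * c ^ (m - i)) *\<^sub>R (F ^^ i) x)"
    by (simp add: Suc linear_sum[OF assms] linear_scale[OF assms])
  also have "c *\<^sub>R (\<Sum>i\<le>m. (real (m choose i) * c ^ (m - i)) *\<^sub>R (F ^^ i) x) = (\<Sum>i\<le>m. g i)"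
    unfolding g_def scaleR_sum_right by (intro sum.cong) (auto simp: Suc_diff_le mult_ac)
  \<comment> \<open>The added term vanishes because \<open>m choose Suc m\<close> is 0; shifting the
    index then lines the two sums up for Pascal's rule.\<close>
  also have "(\<Sum>i\<le>m. g i) = (\<Sum>i\<le>Suc m. g i)"
    by (simp add: g_def)
  also have "\<dots> = g 0 + (\<Sum>i\<le>m. g (Suc i))"
    by (rule sum.atMost_Suc_shift)
  also have "(\<Sum>i\<le>m. (real (m choose i) * c ^ (m - i)) *\<^sub>R (F ^^ Suc i) x) + \<dots>
      = g 0 + (\<Sum>i\<le>m. (real (Suc m choose Suc i) * c ^ (Suc m - Suc i)) *\<^sub>R (F ^^ Suc i) x)"
    by (simp add: g_def sum.distrib[symmetric] algebra_simps)
  also have "\<dots> = (\<Sum>i\<le>Suc m. (real (Suc m choose i) * c ^ (Suc m - i)) *\<^sub>R (F ^^ i) x)"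
    by (subst sum.atMost_Suc_shift) (simp add: g_def)
  finally show ?case .
qed simp

text \<open>\<open>exp (t Q) = exp (-c t) exp (t (Q + c))\<close>, and the second series has non-negative terms.\<close>

lemma exp_series_nonneg:
  fixes Q :: "real ^ 'n::finite \<Rightarrow> real ^ 'n"
  assumes lin: "linear Q"
    and pos: "\<And>g l. (\<And>k. g $ k \<ge> 0) \<Longrightarrow> (Q g + c *\<^sub>R g) $ l \<ge> 0"
    and f: "\<And>k. f $ k \<ge> 0" and "t \<ge> 0"
  shows "(\<Sum>m. (t ^ m / fact m) *\<^sub>R (Q ^^ m) f) $ l \<ge> 0"
proof -
  define F where "F = (\<lambda>g. Q g + c *\<^sub>R g)"
  define a where "a m = ((t ^ m / fact m) *\<^sub>R (Q ^^ m) f) $ l" for m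
  \<comment> \<open>The terms of the scalar series \<open>exp (t * c)\<close>, to be multiplied with
    those of \<open>a\<close> by the Cauchy product.\<close>
  define b where "b m = (t * c) ^ m / fact m" for m
  have Fpos: "(F ^^ m) f $ k \<ge> 0" for m k
  proof (induction m arbitrary: k)
    case (Suc m)
    then show ?case using pos[of "(F ^^ m) f" k] by (simp add: F_def)
  qed (simp add: f)
  have sa: "summable (\<lambda>m. norm (a m))"
    unfolding a_def
    by (rule summable_comparison_test'[OF summable_norm_exp_series[OF lin, of t f], of 0])
       (simp only: real_norm_def abs_idempotent component_le_norm_cart)
  have b: "b = (\<lambda>m. (t * c) ^ m /\<^sub>R fact m)"
    by (simp add: b_def fun_eq_iff field_simps)
  have sb: "summable (\<lambda>m. norm (b m))"
    unfolding b by (rule summable_norm_exp)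
  have "(\<Sum>m. b m) = exp (t * c)"
    unfolding b exp_def ..
  \<comment> \<open>By the binomial theorem the coefficients of the Cauchy product are the terms of
    the series for \<open>F\<close>, which are non-negative.\<close>
  moreover have "(\<Sum>i\<le>m. a i * b (m - i)) = t ^ m / fact m * (F ^^ m) f $ l" for m
  proof -
    have "a i * b (m - i) = t ^ m / fact m * ((real (m choose i) * c ^ (m - i)) *\<^sub>R (Q ^^ i) f) $ l"
      if "i \<le> m" for i
      using that
      by (simp add: a_def b_def binomial_fact power_mult_distrib field_simps power_add[symmetric])
    then show ?thesis
      by (simp add: F_def funpow_add_scaleR[OF lin] sum_distrib_left)
  qed
  ultimately have "(\<Sum>m. a m) * exp (t * c) = (\<Sum>m. t ^ m / fact m * (F ^^ m) f $ l)"
    using Cauchy_product[OF sa sb] by simp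
  also have "\<dots> \<ge> 0"
    using Fpos \<open>t \<ge> 0\<close> summable_Cauchy_product[OF sa sb]
    by (intro suminf_nonneg) (simp_all add: \<open>\<And>m. (\<Sum>i\<le>m. a i * b (m - i)) = _ m\<close>)
  finally have "(\<Sum>m. a m) \<ge> 0"
    by (simp add: zero_le_mult_iff)
  moreover have "(\<Sum>m. a m) = (\<Sum>m. (t ^ m / fact m) *\<^sub>R (Q ^^ m) f) $ l"
    unfolding a_def
    by (rule bounded_linear.suminf[OF bounded_linear_vec_nth summable_exp_series[OF lin], symmetric])
  ultimately show ?thesis by simp
qed

section \<open>Absorbing sets and irreducibility\<close>

text \<open>The derivative at 0 of the quadratic form at \<open>v\<close> is non-negative, yet it is
  minus a sum of squared distances of the \<open>L j *v v\<close> from the range of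
  \<open>p\<close>. Hence every distance is 0.\<close>

lemma subharmonic_range_invariant:
  assumes sub: "subharmonic (semigroup_of (gksl H J L)) p"
    and J: "finite J" "j \<in> J" and pv: "p *v v = v"
  shows "p *v (L j *v v) = L j *v v"
proof -
  \<comment> \<open>The real inner product is the real part of \<open>cinner\<close>, which makes
    \<open>\<phi>\<close> a bounded real functional as \<open>generator_nonneg\<close>
    requires.\<close>
  define \<phi> where "\<phi> A = inner v (A *v v)" for A
  have "linear \<phi>"
    unfolding \<phi>_def
    by (rule linear_compose[OF linear_matrix_vector_mult_left bounded_linear.linear[OF bounded_linear_inner_right],
          unfolded o_def])
  then interpret \<phi>: bounded_linear \<phi> by (rule linear_linear[THEN iffD2, OF _])
  have pp: "p ** p = p" and sa: "cadjoint p = p"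
    using sub by (auto simp: subharmonic_def projection_def selfadjoint_def)
  have inner_p: "inner u (p *v w) = inner (p *v u) w" for u w
    using inner_cadjoint[of u p w] by (simp add: sa)
  have "\<phi> p \<le> \<phi> (semigroup_of (gksl H J L) t p)" if "t \<ge> 0" for t
  proof -
    have "Re (cinner v ((semigroup_of (gksl H J L) t p - p) *v v)) \<ge> 0"
      using sub that
      by (auto simp: subharmonic_def loewner_le_def complex_nonneg_Reals_iff)
    then show ?thesis
      by (simp add: Re_cinner \<phi>_def matrix_vector_mult_diff_rdistrib inner_diff_right)
  qed
  then have "0 \<le> \<phi> (gksl H J L p)"
    by (intro generator_nonneg[OF linear_gksl \<phi>.bounded_linear_axioms])
  also have "\<phi> (gksl H J L p) = - (\<Sum>j\<in>J. (norm (L j *v v - p *v (L j *v v)))\<^sup>2)"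
  proof -
    \<comment> \<open>The Hamiltonian part contributes nothing: \<open>p\<close> fixes
      \<open>v\<close> on both sides of the form, so the two halves of the commutator
      cancel.\<close>
    have "cinner v (p *v (H *v v)) = cinner v (H *v v)"
      using cinner_cadjoint[of p v] by (simp add: sa pv)
    then have "cinner v (commutator H p *v v) = 0"
      using cinner_add_right[of v "p *v (H *v v)" "commutator H p *v v"]
      by (simp add: commutator_def matrix_vector_mult_diff_rdistrib pv
          matrix_vector_mul_assoc[symmetric])
    then have H: "\<phi> (cscale \<i> (commutator H p)) = 0"
      by (simp add: \<phi>_def Re_cinner[symmetric] cscale_mult_vec cinner_scale_right)
    have L: "\<phi> (- (cadjoint (L j) ** L j ** p) + 2 *\<^sub>R (cadjoint (L j) ** p ** L j)
              - p ** cadjoint (L j) ** L j) = - 2 * (norm (L j *v v - p *v (L j *v v)))\<^sup>2" for j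
    proof -
      have 1: "\<phi> (cadjoint (L j) ** L j ** p) = (norm (L j *v v))\<^sup>2"
        by (simp add: \<phi>_def matrix_vector_mul_assoc[symmetric] pv inner_cadjoint power2_norm_eq_inner)
      have 2: "\<phi> (cadjoint (L j) ** p ** L j) = inner (L j *v v) (p *v (L j *v v))"
        by (simp add: \<phi>_def matrix_vector_mul_assoc[symmetric] inner_cadjoint)
      have 3: "\<phi> (p ** cadjoint (L j) ** L j) = (norm (L j *v v))\<^sup>2"
        by (simp add: \<phi>_def matrix_vector_mul_assoc[symmetric] pv inner_p inner_cadjoint
            power2_norm_eq_inner)
      \<comment> \<open>For an orthogonal projection this turns the mixed term into the squared norm
        of \<open>p *v w\<close>; Pythagoras with \<open>w = L j *v v\<close> then yields the square
        of the defect.\<close>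
      have "inner w (p *v w) = inner (p *v w) (p *v w)" for w
        by (simp add: inner_p matrix_vector_mul_assoc pp)
      then show ?thesis
        by (simp add: \<phi>.add \<phi>.diff \<phi>.neg \<phi>.scaleR 1 2 3 power2_norm_eq_inner inner_diff_left
            inner_diff_right inner_commute)
    qed
    show ?thesis
      unfolding gksl_def \<phi>.add \<phi>.scaleR \<phi>.sum H L
      by (simp add: sum_distrib_left[symmetric] sum_negf)
  qed
  finally have "(\<Sum>j\<in>J. (norm (L j *v v - p *v (L j *v v)))\<^sup>2) = 0"
    by (intro antisym sum_nonneg) auto
  then have "(norm (L j *v v - p *v (L j *v v)))\<^sup>2 = 0"
    using J by (subst (asm) sum_nonneg_eq_0_iff) auto
  then show ?thesis by simp
qed

definition absorbing :: "('a \<Rightarrow> 'a \<Rightarrow> real) \<Rightarrow> 'a set \<Rightarrow> bool" where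
  "absorbing \<gamma> C \<longleftrightarrow> (\<forall>l\<in>C. \<forall>k. l \<noteq> k \<longrightarrow> \<gamma> l k > 0 \<longrightarrow> k \<in> C)"

lemma generic_L_mult_vec:
  "generic_L e \<gamma> (l, k) *v v = sqrt (\<gamma> l k) *\<^sub>R (cinner (e l) v *s e k)"
  by (simp add: generic_L_def scaleR_matrix_vector_mult ketbra_mult_vec)

lemma subspace_eq_UNIV:
  assumes "orthonormal_basis e" "vec.subspace W" "\<And>i. e i \<in> W"
  shows "W = UNIV"
proof -
  have "(\<Sum>i\<in>UNIV. cinner (e i) v *s e i) \<in> W" for v
    using assms(2,3) by (intro vec.subspace_sum vec.subspace_scale) auto
  then show ?thesis by (auto simp: orthonormal_expansion[OF assms(1)])
qed

lemma exists_coordinate: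
  assumes "orthonormal_basis e" "\<xi> \<noteq> 0"
  obtains l where "cinner (e l) \<xi> \<noteq> 0"
proof -
  have "\<exists>l. cinner (e l) \<xi> \<noteq> 0"
  proof (rule ccontr)
    assume "\<not> ?thesis"
    then have "(\<Sum>i\<in>UNIV. cinner (e i) \<xi> *s e i) = 0" by simp
    then show False using assms by (simp add: orthonormal_expansion)
  qed
  with that show ?thesis by blast
qed

lemma scaleR_conv_scale: "r *\<^sub>R x = of_real r *s x" for x :: "'n::finite cvec"
  by (simp add: vector_scalar_mult_def scaleR_vec_def scaleR_conv_of_real[where 'a=complex])

lemma subspace_scaleR:
  assumes "vec.subspace W" "(w :: 'n::finite cvec) \<in> W"
  shows "r *\<^sub>R w \<in> W"
  using vec.subspace_scale[OF assms] by (simp add: scaleR_conv_scale)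

text \<open>Irreducibility of the classical Markov chain with rates \<open>\<gamma>\<close>,
  expressed by closed sets instead of paths.\<close>

definition absorbing_trivial :: "('a \<Rightarrow> 'a \<Rightarrow> real) \<Rightarrow> bool" where
  "absorbing_trivial \<gamma> \<longleftrightarrow> (\<forall>C. absorbing \<gamma> C \<longrightarrow> C = {} \<or> C = UNIV)"

text \<open>With at least two states a singleton is a proper non-empty set and so cannot be
  absorbing.\<close>

lemma absorbing_trivial_out_edge:
  assumes "absorbing_trivial \<gamma>" "CARD('n::finite) \<ge> 2"
  obtains k where "l \<noteq> k" "\<gamma> (l::'n) k > 0"
proof -
  have "{l} \<noteq> UNIV"
  proof
    assume "{l} = UNIV"
    then have "CARD('n) = card {l}" by simp
    with assms(2) show False by simp
  qed
  then have "\<not> absorbing \<gamma> {l}"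
    using assms(1) by (auto simp: absorbing_trivial_def)
  with that show ?thesis by (auto simp: absorbing_def)
qed

text \<open>Strips the square root of the rate and the coordinate from the image of a vector under
  some \<open>L\<close>.\<close>

lemma fixed_vector_unscale:
  assumes "p *v (r *\<^sub>R (c *s w)) = r *\<^sub>R (c *s w)" "r \<noteq> 0" "c \<noteq> 0"
  shows "p *v w = (w :: 'n::finite cvec)"
proof -
  have "r *\<^sub>R (c *s w) = (of_real r * c) *s w"
    by (simp add: scaleR_conv_scale)
  with assms have "(of_real r * c) *s (p *v w) = (of_real r * c) *s w"
    by (simp add: vector_scalar_commute)
  then show ?thesis using assms by simp
qed

lemma absorbing_trivial_imp_irreducible:
  fixes e :: "'n::finite \<Rightarrow> 'n cvec"
  assumes e: "orthonormal_basis e" and triv: "absorbing_trivial \<gamma>"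
  shows "irreducible_semigroup (generic_semigroup e \<gamma> H)"
  unfolding irreducible_semigroup_def
proof (intro notI, elim exE conjE)
  fix p :: "'n cmat"
  assume sub: "subharmonic (generic_semigroup e \<gamma> H) p" and "p \<noteq> 0" "p \<noteq> mat 1"
  have pp: "p ** p = p"
    using sub by (simp add: subharmonic_def projection_def)
  obtain v where v: "p *v v \<noteq> 0"
    using \<open>p \<noteq> 0\<close> by (metis matrix_eq matrix_vector_mult_0)
  then obtain l where l: "cinner (e l) (p *v v) \<noteq> 0"
    using exists_coordinate[OF e] by blast
  \<comment> \<open>\<open>L\<close> for the transition from \<open>l\<close> to \<open>k\<close>
    sends a vector with non-zero coordinate at \<open>l\<close> to a non-zero multiple of
    \<open>e k\<close>, which stays in the range of \<open>p\<close>.\<close>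
  have step: "p *v e k = e k" if "p *v w = w" "cinner (e l) w \<noteq> 0" "l \<noteq> k" "\<gamma> l k > 0" for w l k
  proof -
    have "p *v (generic_L e \<gamma> (l, k) *v w) = generic_L e \<gamma> (l, k) *v w"
      using sub that(1,3) unfolding generic_semigroup_def
      by (intro subharmonic_range_invariant[where J = off_diagonal]) (auto simp: off_diagonal_def)
    then show ?thesis
      unfolding generic_L_mult_vec by (rule fixed_vector_unscale) (use that in auto)
  qed
  define C where "C = {k. p *v e k = e k}"
  have "absorbing \<gamma> C"
    unfolding absorbing_def C_def
  proof (intro ballI allI impI CollectI)
    fix l k assume "l \<in> {k. p *v e k = e k}" "l \<noteq> k" "\<gamma> l k > 0"
    then show "p *v e k = e k"
      using e by (intro step[of "e l" l k]) (auto simp: orthonormal_basis_def)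
  qed
  \<comment> \<open>The range vector \<open>p *v v\<close> need not be a basis vector, but one
    transition out of \<open>l\<close> turns it into a multiple of one. In dimension one there are
    no transitions, and \<open>p *v v\<close> is itself a multiple of \<open>e l\<close>.\<close>
  moreover have "C \<noteq> {}"
  proof (cases "CARD('n) \<ge> 2")
    case True
    then obtain k where "l \<noteq> k" "\<gamma> l k > 0"
      using absorbing_trivial_out_edge[OF triv] by blast
    then have "p *v e k = e k"
      using step[of "p *v v" l k] l by (simp add: matrix_vector_mul_assoc pp)
    then show ?thesis by (auto simp: C_def)
  next
    case False
    then have "card (UNIV :: 'n set) = 1"
      using zero_less_card_finite[where 'a='n] by linarith
    then obtain x :: 'n where "UNIV = {x}" by (auto simp: card_1_singleton_iff)
    then have U: "UNIV = {l}" by (metis UNIV_I singletonD)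
    have "cinner (e l) (p *v v) *s e l = p *v v"
      using orthonormal_expansion[OF e, of "p *v v"] by (simp add: U)
    \<comment> \<open>The factor 1 only gives the equation the shape expected by
      \<open>fixed_vector_unscale\<close>.\<close>
    then have "p *v (1 *\<^sub>R (cinner (e l) (p *v v) *s e l)) = 1 *\<^sub>R (cinner (e l) (p *v v) *s e l)"
      by (simp add: matrix_vector_mul_assoc pp)
    then have "p *v e l = e l" by (rule fixed_vector_unscale) (use l in auto)
    then show ?thesis by (auto simp: C_def)
  qed
  ultimately have "C = UNIV" using triv by (auto simp: absorbing_trivial_def)
  have "vec.subspace {w. p *v w = w}"
    by (auto simp: vec.subspace_def matrix_vector_right_distrib vector_scalar_commute)
  then have "{w. p *v w = w} = UNIV"
    using \<open>C = UNIV\<close> by (intro subspace_eq_UNIV[OF e]) (auto simp: C_def)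
  then have "p = mat 1" by (auto simp: matrix_eq)
  with \<open>p \<noteq> mat 1\<close> show False ..
qed

section \<open>Absorbing sets and the Lie algebra rank condition\<close>

text \<open>The product in the reverse order carries the factor \<open>cinner (e l) (e k)\<close>,
  which is 0.\<close>

lemma commutator_ketbra_chain:
  assumes e: "orthonormal_basis e" and "l \<noteq> k"
  shows "commutator (s *\<^sub>R ketbra (e k) (e j)) (r *\<^sub>R ketbra (e j) (e l))
    = (s * r) *\<^sub>R ketbra (e k) (e l)"
  using assms
  by (simp add: commutator_def scalar_matrix_assoc[symmetric] matrix_scalar_ac ketbra_mult
      orthonormal_basis_def cscale_of_real[of 1, simplified])

text \<open>Choose \<open>l\<close> with a non-zero coordinate of \<open>\<xi>\<close>. Matrix units
  from \<open>l\<close> to the other states produce the other basis vectors, and one further bracket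
  produces \<open>e l\<close>.\<close>

lemma absorbing_trivial_imp_LARC:
  fixes e :: "'n::finite \<Rightarrow> 'n cvec"
  assumes e: "orthonormal_basis e" and triv: "absorbing_trivial \<gamma>" and "CARD('n) \<ge> 2"
  shows "LARC H off_diagonal (generic_L e \<gamma>)"
  unfolding LARC_def
proof (intro allI impI)
  fix \<xi> :: "'n cvec"
  assume "\<xi> \<noteq> 0"
  define S where "S = insert (drift_tilde H off_diagonal (generic_L e \<gamma>)) (generic_L e \<gamma> ` off_diagonal)"
  define W where "W = vec.span ((\<lambda>A. A *v \<xi>) ` iterated_commutators S)"
  have W: "vec.subspace W" by (simp add: W_def)
  have in_W: "A *v \<xi> \<in> W" if "A \<in> iterated_commutators S" for A
    using that by (auto simp: W_def intro: vec.span_base)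
  have gen: "sqrt (\<gamma> l k) *\<^sub>R ketbra (e k) (e l) \<in> iterated_commutators S" if "l \<noteq> k" for l k
    using that by (intro iterated_commutators.generator) (force simp: S_def off_diagonal_def generic_L_def)
  have reach: "\<exists>r. r \<noteq> 0 \<and> r *\<^sub>R ketbra (e k) (e l) \<in> iterated_commutators S" if "l \<noteq> k" for l k
  proof -
    \<comment> \<open>The states to which a matrix unit from \<open>l\<close> has been obtained,
      together with the starting state \<open>l\<close>. Since \<open>C\<close> is absorbing and
      non-empty, it contains every state.\<close>
    define C where "C = insert l {j. \<exists>r. r \<noteq> 0 \<and> r *\<^sub>R ketbra (e j) (e l) \<in> iterated_commutators S}"
    have "absorbing \<gamma> C"
      unfolding absorbing_def
    proof (intro ballI allI impI)
      fix j k assume "j \<in> C" "j \<noteq> k" "\<gamma> j k > 0"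
      show "k \<in> C"
      proof (cases "k = l")
        case False
        show ?thesis
        proof (cases "j = l")
          case True
          with gen[of l k] \<open>j \<noteq> k\<close> \<open>\<gamma> j k > 0\<close> show ?thesis
            by (auto simp: C_def intro!: exI[of _ "sqrt (\<gamma> l k)"])
        next
          case False
          then obtain r where "r \<noteq> 0" "r *\<^sub>R ketbra (e j) (e l) \<in> iterated_commutators S"
            using \<open>j \<in> C\<close> by (auto simp: C_def)
          then have "(sqrt (\<gamma> j k) * r) *\<^sub>R ketbra (e k) (e l) \<in> iterated_commutators S"
            using iterated_commutators.bracket[OF gen[OF \<open>j \<noteq> k\<close>]] commutator_ketbra_chain[OF e] \<open>k \<noteq> l\<close>
            by metis
          with \<open>r \<noteq> 0\<close> \<open>\<gamma> j k > 0\<close> show ?thesis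
            by (auto simp: C_def intro!: exI[of _ "sqrt (\<gamma> j k) * r"])
        qed
      qed (simp add: C_def)
    qed
    moreover have "C \<noteq> {}" by (simp add: C_def)
    ultimately have "C = UNIV" using triv by (auto simp: absorbing_trivial_def)
    then show ?thesis using that by (auto simp: C_def)
  qed
  obtain l where l: "cinner (e l) \<xi> \<noteq> 0"
    using exists_coordinate[OF e \<open>\<xi> \<noteq> 0\<close>] .
  have unscale: "w \<in> W" if "r *\<^sub>R (c *s w) \<in> W" "r \<noteq> 0" "c \<noteq> 0" for r c w
  proof -
    have "inverse (of_real r * c) *s (r *\<^sub>R (c *s w)) \<in> W"
      by (rule vec.subspace_scale[OF W that(1)])
    with that(2,3) show ?thesis by (simp add: scaleR_conv_scale del: inverse_mult_distrib)
  qed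
  have off: "e k \<in> W" if kl: "k \<noteq> l" for k
  proof -
    obtain r where r: "r \<noteq> 0" "r *\<^sub>R ketbra (e k) (e l) \<in> iterated_commutators S"
      using reach[OF kl[symmetric]] by blast
    show ?thesis
      using in_W[OF r(2)] r(1) l unscale[of r "cinner (e l) \<xi>"]
      by (simp add: scaleR_matrix_vector_mult ketbra_mult_vec)
  qed
  \<comment> \<open>The bracket of the units \<open>|e_l><e_k|\<close> and \<open>|e_k><e_l|\<close>
    is \<open>|e_l><e_l| - |e_k><e_k|\<close>. Applied to \<open>\<xi>\<close>, its second term is
    already in \<open>W\<close>, which leaves a non-zero multiple of \<open>e l\<close>.\<close>
  obtain k where k: "l \<noteq> k"
    using absorbing_trivial_out_edge[OF triv assms(3)] by blast
  obtain r s where r: "r \<noteq> 0" "r *\<^sub>R ketbra (e k) (e l) \<in> iterated_commutators S"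
    and s: "s \<noteq> 0" "s *\<^sub>R ketbra (e l) (e k) \<in> iterated_commutators S"
    using reach[OF k] reach[OF k[symmetric]] by blast
  have "commutator (s *\<^sub>R ketbra (e l) (e k)) (r *\<^sub>R ketbra (e k) (e l)) *v \<xi>
      = (s * r) *\<^sub>R (cinner (e l) \<xi> *s e l) - (s * r) *\<^sub>R (cinner (e k) \<xi> *s e k)"
    using e by (simp add: commutator_def scalar_matrix_assoc[symmetric] matrix_scalar_ac ketbra_mult
        orthonormal_basis_def cscale_of_real[of 1, simplified] matrix_vector_mult_diff_rdistrib
        scaleR_matrix_vector_mult ketbra_mult_vec)
  moreover have "\<dots> \<in> W"
    using in_W[OF iterated_commutators.bracket[OF s(2) r(2)]] calculation by simp
  moreover have "(s * r) *\<^sub>R (cinner (e k) \<xi> *s e k) \<in> W"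
    using off k by (intro subspace_scaleR[OF W] vec.subspace_scale[OF W]) auto
  ultimately have "(s * r) *\<^sub>R (cinner (e l) \<xi> *s e l) \<in> W"
    using vec.subspace_add[OF W] by (metis diff_add_cancel)
  then have "e l \<in> W" by (rule unscale) (use r s l in auto)
  with off have "e k \<in> W" for k by metis
  then show "vec.span ((\<lambda>A. A *v \<xi>) ` iterated_commutators
      (insert (drift_tilde H off_diagonal (generic_L e \<gamma>)) (generic_L e \<gamma> ` off_diagonal))) = UNIV"
    using subspace_eq_UNIV[OF e W] by (simp add: W_def S_def)
qed

text \<open>There are no transitions, so the drift \<open>- \<i> H\<close> is the only generator; it
  acts as a non-zero scalar, and any non-zero vector spans the space.\<close>

lemma LARC_one_dimensional:
  fixes e :: "'n::finite \<Rightarrow> 'n cvec"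
  assumes e: "orthonormal_basis e" and card: "CARD('n) = 1" and "diagonal_in e H" "H \<noteq> 0"
  shows "LARC H off_diagonal (generic_L e \<gamma>)"
  unfolding LARC_def
proof (intro allI impI)
  fix \<xi> :: "'n cvec"
  assume "\<xi> \<noteq> 0"
  obtain l where l: "cinner (e l) \<xi> \<noteq> 0"
    using exists_coordinate[OF e \<open>\<xi> \<noteq> 0\<close>] .
  obtain x :: 'n where "UNIV = {x}" using card by (auto simp: card_1_singleton_iff)
  then have U: "UNIV = {l}" by (metis UNIV_I singletonD)
  then have eq_l: "k = l" for k by auto
  have exp: "cinner (e l) v *s e l = v" for v
    using orthonormal_expansion[OF e, of v] by (simp add: U)
  define h where "h = cinner (e l) (H *v e l)"
  have h: "H *v v = h *s v" for v
    using diagonal_in_eigenvector[OF assms(1,3), of l] exp[of v]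
    by (metis h_def vector_scalar_commute vector_smult_assoc mult.commute)
  have "h \<noteq> 0"
    using \<open>H \<noteq> 0\<close> h by (auto simp: matrix_eq)
  have "off_diagonal = ({} :: ('n \<times> 'n) set)"
    using eq_l by (metis (mono_tags, lifting) off_diagonal_def case_prodE empty_iff equals0I mem_Collect_eq)
  then have "drift_tilde H off_diagonal (generic_L e \<gamma>) = 0 - cscale \<i> H"
    by (simp add: drift_tilde_def drift_def)
  then have drift: "drift_tilde H off_diagonal (generic_L e \<gamma>) *v \<xi> = (- \<i> * h) *s \<xi>"
    by (simp only: matrix_vector_mult_diff_rdistrib cscale_mult_vec h) (simp add: vec_eq_iff)
  have mem: "(- \<i> * h) *s \<xi> \<in> vec.span ((\<lambda>A. A *v \<xi>) ` iterated_commutators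
      (insert (drift_tilde H off_diagonal (generic_L e \<gamma>)) (generic_L e \<gamma> ` off_diagonal)))" (is "_ \<in> ?W")
    unfolding drift[symmetric]
    by (intro vec.span_base imageI iterated_commutators.generator insertI1)
  define c where "c = - \<i> * h * cinner (e l) \<xi>"
  have "inverse c *s ((- \<i> * h) *s (cinner (e l) \<xi> *s e l)) \<in> ?W"
    unfolding exp by (rule vec.span_scale[OF mem])
  moreover have "inverse c *s ((- \<i> * h) *s (cinner (e l) \<xi> *s e l)) = (inverse c * c) *s e l"
    by (simp only: vector_smult_assoc c_def mult.assoc)
  moreover have "c \<noteq> 0" using l \<open>h \<noteq> 0\<close> by (simp add: c_def)
  ultimately have "e l \<in> ?W" by simp
  then have "e i \<in> ?W" for i by (simp only: eq_l[of i])
  then show "?W = UNIV" by (rule subspace_eq_UNIV[OF e vec.subspace_span])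
qed

text \<open>If \<open>C\<close> were a proper non-empty absorbing set, all iterated commutators
  would keep \<open>e c\<close> with \<open>c \<in> C\<close> inside the span \<open>W\<close> of
  \<open>C\<close>, a proper subspace.\<close>

lemma LARC_imp_absorbing_trivial:
  fixes e :: "'n::finite \<Rightarrow> 'n cvec"
  assumes e: "orthonormal_basis e" and nonneg: "\<And>l k. l \<noteq> k \<Longrightarrow> \<gamma> l k \<ge> 0"
    and H: "diagonal_in e H"
    and larc: "LARC H off_diagonal (generic_L e \<gamma>)"
  shows "absorbing_trivial \<gamma>"
  unfolding absorbing_trivial_def
proof (intro allI impI, rule ccontr)
  fix C assume C: "absorbing \<gamma> C" and "\<not> (C = {} \<or> C = UNIV)"
  then obtain c d where c: "c \<in> C" and d: "d \<notin> C" by auto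
  define W where "W = vec.span (e ` C)"
  have W: "vec.subspace W" by (simp add: W_def)
  have eW: "e i \<in> W" if "i \<in> C" for i
    using that by (auto simp: W_def intro: vec.span_base)
  define inv where "inv A \<longleftrightarrow> (\<forall>v\<in>W. A *v v \<in> W)" for A
  have invI: "inv A" if "\<And>i. i \<in> C \<Longrightarrow> A *v e i \<in> W" for A
    unfolding inv_def
  proof
    fix v assume "v \<in> W"
    then show "A *v v \<in> W"
      unfolding W_def
    proof (induction rule: vec.span_induct)
      case base
      show ?case
        by (auto simp: vec.subspace_def matrix_vector_right_distrib vector_scalar_commute
            intro: vec.span_add vec.span_scale vec.span_zero)
    qed (use that in \<open>auto simp: W_def\<close>)
  qed
  have L: "inv (generic_L e \<gamma> (l, k))" if "l \<noteq> k" for l k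
  proof (rule invI)
    fix i assume "i \<in> C"
    show "generic_L e \<gamma> (l, k) *v e i \<in> W"
    proof (cases "i = l \<and> \<gamma> l k > 0")
      case True
      then have "k \<in> C" using C \<open>i \<in> C\<close> that by (auto simp: absorbing_def)
      then show ?thesis
        unfolding generic_L_mult_vec by (intro subspace_scaleR vec.subspace_scale W eW)
    next
      \<comment> \<open>Either orthogonality kills \<open>e i\<close>, or the rate, being
        non-negative but not positive, is 0.\<close>
      case False
      then have "generic_L e \<gamma> (l, k) *v e i = 0"
        using e nonneg[OF that] by (auto simp: generic_L_mult_vec orthonormal_basis_def)
      then show ?thesis by (simp add: vec.subspace_0[OF W])
    qed
  qed
  have inv_diff: "inv (A - B)" and inv_mult: "inv (A ** B)" if "inv A" "inv B" for A B
    using that by (auto simp: inv_def matrix_vector_mult_diff_rdistrib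
        simp flip: matrix_vector_mul_assoc intro: vec.subspace_diff[OF W])
  have inv_scaleR: "inv (r *\<^sub>R A)" if "inv A" for r A
    using that by (auto simp: inv_def scaleR_matrix_vector_mult intro: subspace_scaleR[OF W])
  have inv_cscale: "inv (cscale z A)" if "inv A" for z A
    using that by (auto simp: inv_def cscale_mult_vec intro: vec.subspace_scale[OF W])
  have inv_sum: "inv (\<Sum>j\<in>J. f j)" if "\<And>j. j \<in> J \<Longrightarrow> inv (f j)" for J f
    using that by (auto simp: inv_def linear_sum[OF linear_matrix_vector_mult_left]
        intro: vec.subspace_sum[OF W])
  have "inv H"
    using eW by (intro invI) (subst diagonal_in_eigenvector[OF e H], intro vec.subspace_scale[OF W])
  \<comment> \<open>This product is a real multiple of \<open>|e_l><e_l|\<close>, hence diagonal in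
    \<open>e\<close>, and preserves the span of any set of basis vectors.\<close>
  have LL: "inv (cadjoint (generic_L e \<gamma> (l, k)) ** generic_L e \<gamma> (l, k))" for l k
  proof (rule invI)
    fix i assume "i \<in> C"
    have "(cadjoint (generic_L e \<gamma> (l, k)) ** generic_L e \<gamma> (l, k)) *v e i
        = (sqrt (\<gamma> l k) * sqrt (\<gamma> l k)) *\<^sub>R (cinner (e l) (e i) *s (cinner (e k) (e k) *s e l))"
      by (simp add: generic_L_def cadjoint_scaleR cadjoint_ketbra scaleR_matrix_vector_mult
          ketbra_mult_vec scaleR_conv_scale cinner_scale_right mult_ac del: real_sqrt_mult_self
          flip: matrix_vector_mul_assoc)
    also have "\<dots> \<in> W"
      using e \<open>i \<in> C\<close> by (cases "i = l")
        (auto simp: orthonormal_basis_def vec.subspace_0[OF W] intro!: subspace_scaleR[OF W] eW)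
    finally show "(cadjoint (generic_L e \<gamma> (l, k)) ** generic_L e \<gamma> (l, k)) *v e i \<in> W" .
  qed
  have drift: "inv (drift_tilde H off_diagonal (generic_L e \<gamma>))"
  proof -
    have neg: "inv (- M)" if "inv M" for M
      using inv_diff[of 0 M] that by (simp add: inv_def vec.subspace_0[OF W])
    have LL': "inv (cadjoint (generic_L e \<gamma> j) ** generic_L e \<gamma> j)" for j
      using LL[of "fst j" "snd j"] by simp
    have L': "inv (generic_L e \<gamma> j)" if "j \<in> off_diagonal" for j
      using L[of "fst j" "snd j"] that by (auto simp: off_diagonal_def)
    show ?thesis
      unfolding drift_tilde_def drift_def
      by (intro inv_diff neg inv_scaleR inv_cscale inv_sum \<open>inv H\<close> LL' inv_mult[OF L' L'])
  qed
  have "inv A" if "A \<in> iterated_commutators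
      (insert (drift_tilde H off_diagonal (generic_L e \<gamma>)) (generic_L e \<gamma> ` off_diagonal))" for A
    using that
  proof induction
    case (generator A)
    then show ?case using drift L by (auto simp: off_diagonal_def)
  next
    case (bracket A B)
    then show ?case
      unfolding commutator_def by (intro inv_diff inv_mult)
  qed
  then have "vec.span ((\<lambda>A. A *v e c) ` iterated_commutators
      (insert (drift_tilde H off_diagonal (generic_L e \<gamma>)) (generic_L e \<gamma> ` off_diagonal))) \<subseteq> W"
    using eW[OF c] W by (intro vec.span_minimal) (auto simp: inv_def)
  moreover have "e c \<noteq> 0"
    using e unfolding orthonormal_basis_def by (metis cinner_0_right zero_neq_one)
  ultimately have "W = UNIV" using larc by (auto simp: LARC_def)
  \<comment> \<open>\<open>W\<close> is orthogonal to \<open>e d\<close> for the state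
    \<open>d\<close> outside \<open>C\<close>, so it cannot be the whole space.\<close>
  have "vec.subspace {v. cinner (e d) v = 0}"
    by (auto simp: vec.subspace_def cinner_add_right cinner_scale_right)
  then have "W \<subseteq> {v. cinner (e d) v = 0}"
    unfolding W_def using e d by (intro vec.span_minimal) (auto simp: orthonormal_basis_def)
  then have "cinner (e d) (e d) = 0" using \<open>W = UNIV\<close> by auto
  then show False using e by (simp add: orthonormal_basis_def)
qed

section \<open>The classical Markov semigroup on diagonal matrices\<close>

definition diag_op :: "('n::finite \<Rightarrow> 'n cvec) \<Rightarrow> real ^ 'n \<Rightarrow> 'n cmat" where
  "diag_op e f = (\<Sum>l\<in>UNIV. (f $ l) *\<^sub>R ketbra (e l) (e l))"

text \<open>The classical generator induced on the diagonal.\<close>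

definition rate_op :: "('n::finite \<Rightarrow> 'n \<Rightarrow> real) \<Rightarrow> real ^ 'n \<Rightarrow> real ^ 'n" where
  "rate_op \<gamma> f = (\<chi> l. \<Sum>k\<in>UNIV. \<gamma> l k * (f $ k - f $ l))"

lemma linear_diag_op: "linear (diag_op e)"
  by (rule linearI) (simp_all add: diag_op_def scaleR_left_distrib sum.distrib scaleR_sum_right)

lemma linear_rate_op: "linear (rate_op \<gamma>)"
  by (rule linearI)
     (simp_all add: rate_op_def vec_eq_iff sum.distrib[symmetric] sum_distrib_left algebra_simps)

lemma diag_op_mult_vec:
  "diag_op e f *v v = (\<Sum>l\<in>UNIV. of_real (f $ l) *s (cinner (e l) v *s e l))"
  by (simp add: diag_op_def linear_sum[OF linear_matrix_vector_mult_left] scaleR_matrix_vector_mult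
      ketbra_mult_vec scaleR_conv_scale)

text \<open>Through this formula the pointwise order of functions becomes the order of the
  corresponding matrices.\<close>

lemma cinner_diag_op:
  "cinner v (diag_op e f *v v) = of_real (\<Sum>l\<in>UNIV. f $ l * (cmod (cinner (e l) v))\<^sup>2)"
proof -
  have "cinner (e l) v * cinner v (e l) = of_real ((cmod (cinner (e l) v))\<^sup>2)" for l
    by (metis cnj_cinner complex_norm_square of_real_power)
  then show ?thesis
    by (simp add: diag_op_mult_vec cinner_sum_right cinner_scale_right mult.assoc)
qed

lemma diag_op_mult_basis:
  assumes "orthonormal_basis e"
  shows "diag_op e f *v e i = of_real (f $ i) *s e i"
proof -
  have "diag_op e f *v e i = (\<Sum>l\<in>UNIV. if l = i then of_real (f $ i) *s e i else 0)"
    unfolding diag_op_mult_vec using assms by (intro sum.cong) (auto simp: orthonormal_basis_def)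
  then show ?thesis by simp
qed

lemma cadjoint_diag_op: "cadjoint (diag_op e f) = diag_op e f"
  by (simp add: diag_op_def cadjoint_sum cadjoint_scaleR cadjoint_ketbra)

text \<open>Self-adjointness makes the eigenvalues of \<open>H\<close> real, so \<open>H\<close>
  multiplies each \<open>|e_l><e_l|\<close> by the same number from the left and from the
  right.\<close>

lemma commutator_diag_op:
  assumes e: "orthonormal_basis e" and H: "selfadjoint H" "diagonal_in e H"
  shows "commutator H (diag_op e f) = 0"
proof -
  have "commutator H (ketbra (e l) (e l)) = 0" for l
  proof -
    define h where "h = cinner (e l) (H *v e l)"
    have "cadjoint H = H" using H(1) by (simp add: selfadjoint_def)
    then have "cnj h = h"
      by (metis h_def cnj_cinner cinner_cadjoint)
    moreover have "H *v e l = h *s e l"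
      unfolding h_def by (rule diagonal_in_eigenvector[OF e H(2)])
    ultimately show ?thesis
      by (simp add: commutator_def mult_ketbra ketbra_mult' \<open>cadjoint H = H\<close> ketbra_scale_left
          ketbra_scale_right)
  qed
  moreover have "linear (commutator H)"
    unfolding commutator_def
    by (intro linear_compose_sub linear_matrix_mult_left linear_matrix_mult_right)
  ultimately show ?thesis
    by (simp add: diag_op_def linear_sum linear_scale)
qed

lemma gksl_diag_op:
  assumes e: "orthonormal_basis e" and nonneg: "\<And>l k. l \<noteq> k \<Longrightarrow> \<gamma> l k \<ge> 0"
    and H: "selfadjoint H" "diagonal_in e H"
  shows "gksl H off_diagonal (generic_L e \<gamma>) (diag_op e f) = diag_op e (rate_op \<gamma> f)"
proof -
  let ?D = "diag_op e f"
  \<comment> \<open>The value of a single GKSL summand; its factor 2 cancels against the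
    \<open>1/2\<close> in \<open>gksl\<close>.\<close>
  define g where "g = (\<lambda>(l, k). (2 * (\<gamma> l k * (f $ k - f $ l))) *\<^sub>R ketbra (e l) (e l))"
  have D: "?D *v e l = of_real (f $ l) *s e l" for l
    by (rule diag_op_mult_basis[OF e])
  have e1: "cinner (e k) (e k) = 1" for k
    using e by (simp add: orthonormal_basis_def)
  have cs: "cscale 1 A = A" for A
    using cscale_of_real[of 1 A] by simp
  have summand: "- (cadjoint (generic_L e \<gamma> j) ** generic_L e \<gamma> j ** ?D)
      + 2 *\<^sub>R (cadjoint (generic_L e \<gamma> j) ** ?D ** generic_L e \<gamma> j)
      - ?D ** cadjoint (generic_L e \<gamma> j) ** generic_L e \<gamma> j = g j"
    if j: "j \<in> off_diagonal" for j
  proof -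
    obtain l k where lk: "j = (l, k)" "l \<noteq> k"
      using j by (auto simp: off_diagonal_def)
    have \<gamma>: "sqrt (\<gamma> l k) * sqrt (\<gamma> l k) = \<gamma> l k"
      using nonneg[OF lk(2)] by simp
    have L: "generic_L e \<gamma> j = sqrt (\<gamma> l k) *\<^sub>R ketbra (e k) (e l)"
      by (simp add: lk generic_L_def)
    have DK: "?D ** ketbra (e l) u = (f $ l) *\<^sub>R ketbra (e l) u" for u
      by (simp add: mult_ketbra D ketbra_scale_left cscale_of_real)
    have 1: "cadjoint (generic_L e \<gamma> j) ** generic_L e \<gamma> j ** ?D = (\<gamma> l k * f $ l) *\<^sub>R ketbra (e l) (e l)"
      unfolding L
      by (simp add: cadjoint_scaleR cadjoint_ketbra scalar_matrix_assoc[symmetric] matrix_scalar_ac ketbra_mult e1 cs ketbra_mult'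
          cadjoint_diag_op D ketbra_mult_vec ketbra_scale_right cscale_of_real \<gamma> del: real_sqrt_mult_self)
    have 2: "cadjoint (generic_L e \<gamma> j) ** ?D ** generic_L e \<gamma> j = (\<gamma> l k * f $ k) *\<^sub>R ketbra (e l) (e l)"
      unfolding L
      by (simp add: cadjoint_scaleR cadjoint_ketbra scalar_matrix_assoc[symmetric] matrix_scalar_ac ketbra_mult e1 cs ketbra_mult'
          cadjoint_diag_op D ketbra_mult_vec ketbra_scale_right cscale_of_real \<gamma> del: real_sqrt_mult_self)
    have 3: "?D ** cadjoint (generic_L e \<gamma> j) ** generic_L e \<gamma> j = (\<gamma> l k * f $ l) *\<^sub>R ketbra (e l) (e l)"
      unfolding L
      by (simp add: cadjoint_scaleR cadjoint_ketbra linear_scale[OF linear_matrix_mult_left]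
          linear_scale[OF linear_matrix_mult_right] DK ketbra_mult e1 cs \<gamma>
          del: real_sqrt_mult_self)
    show ?thesis
      unfolding 1 2 3 unfolding g_def lk by (simp add: algebra_simps flip: scaleR_add_left)
  qed
  \<comment> \<open>Pairs with \<open>l = k\<close> may be added because there the difference of the
    values of \<open>f\<close> is 0.\<close>
  have "(\<Sum>j\<in>off_diagonal. g j) = (\<Sum>j\<in>UNIV. g j)"
    by (rule sum.mono_neutral_left) (auto simp: off_diagonal_def g_def)
  also have "\<dots> = (\<Sum>l\<in>UNIV. \<Sum>k\<in>UNIV. g (l, k))"
    by (simp add: sum.cartesian_product flip: UNIV_Times_UNIV)
  also have "\<dots> = 2 *\<^sub>R diag_op e (rate_op \<gamma> f)"
    by (simp add: diag_op_def rate_op_def g_def scaleR_sum_right scaleR_sum_left sum_distrib_left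
        mult.assoc)
  finally have "(\<Sum>j\<in>off_diagonal. g j) = 2 *\<^sub>R diag_op e (rate_op \<gamma> f)" .
  then show ?thesis
    unfolding gksl_def commutator_diag_op[OF e H]
    by (subst sum.cong[OF refl summand]) (simp_all add: linear_0[OF linear_cscale])
qed

lemma generic_semigroup_diag_op:
  assumes e: "orthonormal_basis e" and nonneg: "\<And>l k. l \<noteq> k \<Longrightarrow> \<gamma> l k \<ge> 0"
    and H: "selfadjoint H" "diagonal_in e H"
  shows "generic_semigroup e \<gamma> H t (diag_op e f)
    = diag_op e (\<Sum>m. (t ^ m / fact m) *\<^sub>R (rate_op \<gamma> ^^ m) f)"
proof -
  have pow: "(gksl H off_diagonal (generic_L e \<gamma>) ^^ m) (diag_op e f) = diag_op e ((rate_op \<gamma> ^^ m) f)" for m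
    by (induction m) (simp_all add: gksl_diag_op[OF assms])
  have "bounded_linear (diag_op e)"
    using linear_diag_op by (simp add: linear_conv_bounded_linear)
  from bounded_linear.suminf[OF this summable_exp_series[OF linear_rate_op]]
  show ?thesis
    by (simp add: generic_semigroup_def semigroup_of_def pow linear_scale[OF linear_diag_op])
qed

text \<open>Supplies the shift for \<open>exp_series_nonneg\<close>: the constant dominates the exit
  rate of every state. The absolute values also cover the entries \<open>\<gamma> l l\<close>, whose
  sign is arbitrary.\<close>

lemma rate_op_shift_nonneg:
  assumes nonneg: "\<And>l k. l \<noteq> k \<Longrightarrow> \<gamma> l k \<ge> 0" and g: "\<And>k. g $ k \<ge> 0"
  shows "(rate_op \<gamma> g + (\<Sum>l\<in>UNIV. \<Sum>k\<in>UNIV. \<bar>\<gamma> l k\<bar>) *\<^sub>R g) $ i \<ge> 0"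
proof -
  have "- (\<bar>\<gamma> i k\<bar> * g $ i) \<le> \<gamma> i k * (g $ k - g $ i)" for k
  proof (cases "k = i")
    case False
    then have "0 \<le> \<gamma> i k * g $ k"
      using nonneg g by (metis mult_nonneg_nonneg)
    then show ?thesis using False nonneg[of i k] by (simp add: algebra_simps)
  qed (use g in simp)
  then have "- ((\<Sum>k\<in>UNIV. \<bar>\<gamma> i k\<bar>) * g $ i) \<le> (\<Sum>k\<in>UNIV. \<gamma> i k * (g $ k - g $ i))"
    by (auto simp: sum_distrib_right sum_negf[symmetric] intro!: sum_mono)
  moreover have "(\<Sum>k\<in>UNIV. \<bar>\<gamma> i k\<bar>) \<le> (\<Sum>l\<in>UNIV. \<Sum>k\<in>UNIV. \<bar>\<gamma> l k\<bar>)"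
    by (rule member_le_sum[of i UNIV "\<lambda>l. \<Sum>k\<in>UNIV. \<bar>\<gamma> l k\<bar>"]) (auto intro: sum_nonneg)
  then have "(\<Sum>k\<in>UNIV. \<bar>\<gamma> i k\<bar>) * g $ i \<le> (\<Sum>l\<in>UNIV. \<Sum>k\<in>UNIV. \<bar>\<gamma> l k\<bar>) * g $ i"
    using g by (intro mult_right_mono)
  ultimately show ?thesis by (simp add: rate_op_def)
qed

text \<open>The projection for a proper absorbing set \<open>C\<close> evolves as the indicator of
  \<open>C\<close> under the classical semigroup, which stays 1 on \<open>C\<close> and non-negative
  elsewhere. It is therefore a non-trivial subharmonic projection.\<close>

lemma irreducible_imp_absorbing_trivial:
  fixes e :: "'n::finite \<Rightarrow> 'n cvec"
  assumes e: "orthonormal_basis e" and nonneg: "\<And>l k. l \<noteq> k \<Longrightarrow> \<gamma> l k \<ge> 0"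
    and H: "selfadjoint H" "diagonal_in e H"
    and irr: "irreducible_semigroup (generic_semigroup e \<gamma> H)"
  shows "absorbing_trivial \<gamma>"
  unfolding absorbing_trivial_def
proof (intro allI impI, rule ccontr)
  fix C assume C: "absorbing \<gamma> C" and "\<not> (C = {} \<or> C = UNIV)"
  then obtain c d where c: "c \<in> C" and d: "d \<notin> C" by auto
  define f :: "real ^ 'n" where "f = (\<chi> l. indicator C l)"
  define p where "p = diag_op e f"
  have e0: "e i \<noteq> 0" for i
    using e unfolding orthonormal_basis_def by (metis cinner_0_right zero_neq_one)
  have "p *v (p *v v) = p *v v" for v
  proof -
    have "p *v (p *v v) = (\<Sum>l\<in>UNIV. of_real (f $ l) *s (cinner (e l) v *s (p *v e l)))"
      by (subst (2) p_def, subst diag_op_mult_vec) (simp add: vec.sum vec.scale)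
    also have "\<dots> = p *v v"
      unfolding p_def diag_op_mult_basis[OF e] unfolding diag_op_mult_vec
      by (intro sum.cong) (auto simp: f_def indicator_def)
    finally show ?thesis .
  qed
  then have proj: "projection p"
    by (simp add: projection_def selfadjoint_def p_def cadjoint_diag_op)
       (simp add: matrix_eq matrix_vector_mul_assoc[symmetric] p_def)
  have "loewner_le p (generic_semigroup e \<gamma> H t p)" if "t \<ge> 0" for t
  proof -
    define g where "g = (\<Sum>m. (t ^ m / fact m) *\<^sub>R (rate_op \<gamma> ^^ m) f)"
    have summ: "summable (\<lambda>m. (t ^ m / fact m) *\<^sub>R (rate_op \<gamma> ^^ m) f)"
      by (rule summable_exp_series[OF linear_rate_op])
    have "g $ l \<ge> f $ l" for l
    proof (cases "l \<in> C")
      case False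
      have "g $ l \<ge> 0"
        unfolding g_def
        by (rule exp_series_nonneg[OF linear_rate_op rate_op_shift_nonneg[OF nonneg] _ that])
           (auto simp: f_def)
      with False show ?thesis by (simp add: f_def)
    next
      case True
      have outside: "\<gamma> i k = 0" if "i \<in> C" "k \<notin> C" for i k
        using C nonneg[of i k] that unfolding absorbing_def by (metis antisym_conv1)
      \<comment> \<open>On \<open>C\<close> the classical generator sees only values on
        \<open>C\<close>, because the rates leaving \<open>C\<close> are 0; a function constant on
        \<open>C\<close> is thus mapped to 0 there.\<close>
      have van: "(rate_op \<gamma> h) $ i = 0" if "\<And>i. i \<in> C \<Longrightarrow> h $ i = a" "i \<in> C" for h a i
        unfolding rate_op_def using that outside by (auto intro!: sum.neutral) metis
      \<comment> \<open>The indicator has the constant value 1 on \<open>C\<close> and all later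
        iterates the value 0, so on \<open>C\<close> only the zeroth term of the series
        survives.\<close>
      have pow: "((rate_op \<gamma> ^^ Suc m) f) $ i = 0" if "i \<in> C" for m i
        using that
      proof (induction m arbitrary: i)
        case 0
        have "f $ i = 1" if "i \<in> C" for i using that by (simp add: f_def)
        from van[OF this 0] show ?case by simp
      next
        case (Suc m)
        then show ?case
          using van[of "(rate_op \<gamma> ^^ Suc m) f" 0 i] by simp
      qed
      have "g $ l = (\<Sum>m. ((t ^ m / fact m) *\<^sub>R (rate_op \<gamma> ^^ m) f) $ l)"
        unfolding g_def by (rule bounded_linear.suminf[OF bounded_linear_vec_nth summ])
      also have "\<dots> = (\<Sum>m\<in>{0}. ((t ^ m / fact m) *\<^sub>R (rate_op \<gamma> ^^ m) f) $ l)"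
      proof (rule suminf_finite)
        fix m :: nat assume "m \<notin> {0}"
        then obtain m' where "m = Suc m'" by (cases m) auto
        then show "((t ^ m / fact m) *\<^sub>R (rate_op \<gamma> ^^ m) f) $ l = 0"
          using pow[OF True, of m'] by simp
      qed simp
      finally show ?thesis by simp
    qed
    then have nn: "(\<Sum>l\<in>UNIV. (g - f) $ l * (cmod (cinner (e l) v))\<^sup>2) \<ge> 0" for v
      by (intro sum_nonneg) simp
    have "generic_semigroup e \<gamma> H t p = diag_op e g"
      unfolding p_def g_def by (rule generic_semigroup_diag_op[OF e nonneg H])
    then have "generic_semigroup e \<gamma> H t p - p = diag_op e (g - f)"
      by (simp add: p_def linear_diff[OF linear_diag_op])
    then show ?thesis
      unfolding loewner_le_def
      by (simp only: cinner_diag_op complex_nonneg_Reals_iff Re_complex_of_real Im_complex_of_real nn)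
        simp
  qed
  with proj have "subharmonic (generic_semigroup e \<gamma> H) p"
    by (simp add: subharmonic_def)
  moreover have "p *v e c = e c" "p *v e d = 0"
    using c d by (simp_all add: p_def diag_op_mult_basis[OF e] f_def)
  then have "p \<noteq> 0" "p \<noteq> mat 1"
    using e0 by force+
  ultimately show False using irr by (auto simp: irreducible_semigroup_def)
qed

text \<open>The last hypothesis excludes exactly dimension one with \<open>H = 0\<close>: there all
  generators of the Lie algebra vanish and the rank condition fails, although no non-trivial
  projection exists.\<close>

theorem theorem12:
  fixes e :: "'n::finite \<Rightarrow> complex ^ 'n"
    and \<gamma> :: "'n \<Rightarrow> 'n \<Rightarrow> real"
    and H :: "complex ^ 'n ^ 'n"
  assumes "orthonormal_basis e"
    and "\<And>l k. l \<noteq> k \<Longrightarrow> \<gamma> l k \<ge> 0"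
    and "selfadjoint H"
    and "diagonal_in e H"
    and "CARD('n) \<ge> 2 \<or> H \<noteq> 0"
  shows "irreducible_semigroup (generic_semigroup e \<gamma> H)
         \<longleftrightarrow> LARC H off_diagonal (generic_L e \<gamma>)"
proof -
  have "irreducible_semigroup (generic_semigroup e \<gamma> H) \<longleftrightarrow> absorbing_trivial \<gamma>"
    by (rule iffI[OF irreducible_imp_absorbing_trivial[OF assms(1-4)]
          absorbing_trivial_imp_irreducible[OF assms(1)]])
  moreover have "LARC H off_diagonal (generic_L e \<gamma>)" if "absorbing_trivial \<gamma>"
  proof (cases "CARD('n) \<ge> 2")
    case True
    then show ?thesis by (rule absorbing_trivial_imp_LARC[OF assms(1) that])
  next
    case False
    moreover have "CARD('n) > 0" by simp
    ultimately have "CARD('n) = 1" "H \<noteq> 0" using assms(5) by linarith+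
    then show ?thesis using LARC_one_dimensional[OF assms(1) _ assms(4)] by blast
  qed
  moreover have "absorbing_trivial \<gamma>" if "LARC H off_diagonal (generic_L e \<gamma>)"
    by (rule LARC_imp_absorbing_trivial[OF assms(1,2,4) that])
  ultimately show ?thesis by blast
qed

end
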